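(* Let $d\ge 1$ and $n\ge 1$ be integers, let $S_d\subset\mathbb{R}^d$ be a simplex (the convex hull of $d+1$ points in general position), and let $N=\binom{n+d}{d}$. Let $F\subset S_d$ be a set of $N$ distinct points and let $$\mu=\sum_{\mathbf a\in F} w_{\mathbf a}\,\delta_{\mathbf a},\qquad w_{\mathbf a}>0,\qquad \sum_{\mathbf a\in F}w_{\mathbf a}=1,$$ be a discrete probability measure supported on $F$. Then $\mu$ is an optimal measure for degree $n$ if and only if $w_{\mathbf a}=1/N$ for all $\mathbf a\in F$ and $F$ is a Fejér set of degree $n$.
   Context: Let $\mathcal{P}_n(\mathbb{R}^d)$ be the space of real polynomials of total degree at most $n$ in $d$ variables, of dimension $N=N_n=\binom{n+d}{d}$, and let $p_1,\dots,p_N$ be a basis of it. For points $\mathbf x_1,\dots,\mathbf x_N\in S_d$ put $\mathrm{vdm}(\mathbf x_1,\dots,\mathbf x_N)=\det([p_j(\mathbf x_i)]_{1\le i,j\le N})$. If this is nonzero, the fundamental Lagrange polynomials $\ell_1,\dots,\ell_N\in\mathcal{P}_n(\mathbb{R}^d)$ are those determined by $\ell_i(\mathbf x_j)=\delta_{ij}$. Fejér set: a set $F=\{\mathbf x_1,\dots,\mathbf x_N\}\subset S_d$ of $N$ distinct points, with nonzero Vandermonde determinant (so that the Lagrange polynomials of degree $n$ exist), is a Fejér set (of degree $n$) if $\max_{\mathbf x\in S_d}\sum_{i=1}^{N}\ell_i^2(\mathbf x)=1$. Optimal measure: let $\mathcal M(S_d)$ be the set of probability measures supported on $S_d$, and for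 $\mu\in\mathcal M(S_d)$ let $G_n(\mu)=\left[\int_{S_d}p_ip_j\,d\mu\right]_{1\le i,j\le N}$ be the Gram matrix. The measure $\mu$ is D-optimal if $\det G_n(\mu)$ is maximal among all measures in $\mathcal M(S_d)$. It is G-optimal if $\max_{\mathbf x\in S_d}K_n(\mathbf x,\mathbf x)$ is minimal among all measures in $\mathcal M(S_d)$ for which the kernel is defined, where $K_n(\mathbf x,\mathbf x)=\sum_{i=1}^N P_i^2(\mathbf x)$ for any orthonormal basis $P_1,\dots,P_N$ of $\mathcal P_n(\mathbb{R}^d)$ with respect to the inner product $\int_{S_d} pq\,d\mu$. By the Kiefer–Wolfowitz equivalence theorem $\mu$ is D-optimal if and only if it is G-optimal, and in that case $\max_{\mathbf x\in S_d}K_n(\mathbf x,\mathbf x)=N$, attained at all points of the support of $\mu$. A D-optimal (equivalently G-optimal) measure is called an optimal measure for degree $n$. *)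

theory Defs
  imports "HOL-Probability.Probability" "Jordan_Normal_Form.Determinant"
begin

hide_const (open) Matrix.vec Finite_Cartesian_Product.mat Determinants.det

text \<open>
  Polynomials on \<open>\<real>\<^sup>d\<close> are treated as functions on \<^typ>\<open>real^'d\<close>, written in the monomials
  indexed by exponent vectors \<^typ>\<open>'d \<Rightarrow> nat\<close>.  Families with \<open>N\<close> members (bases, points,
  Lagrange polynomials, rows and columns of matrices) are indexed by \<open>0, \<dots>, N - 1\<close>, which
  agrees with the matrices of \<^theory>\<open>Jordan_Normal_Form.Matrix\<close>.
\<close>

definition polys :: "nat \<Rightarrow> (real^'d \<Rightarrow> real) set" where
  "polys n = {q. \<exists>c. q = (\<lambda>x. \<Sum>\<alpha> | (\<Sum>i\<in>UNIV. \<alpha> i) \<le> n. c \<alpha> * (\<Prod>i\<in>UNIV. vec_nth x i ^ \<alpha> i))}"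

text \<open>The set of exponent vectors in \<^const>\<open>polys\<close> is finite, so the sum there is a genuine one.\<close>

lemma finite_exponents: "finite {\<alpha> :: 'd::finite \<Rightarrow> nat. (\<Sum>i\<in>UNIV. \<alpha> i) \<le> n}"
proof (rule finite_subset)
  have "\<alpha> i \<le> n" if "(\<Sum>i\<in>UNIV. \<alpha> i) \<le> n" for \<alpha> :: "'d \<Rightarrow> nat" and i
    using member_le_sum[of i UNIV \<alpha>] that by simp
  then show "{\<alpha> :: 'd \<Rightarrow> nat. (\<Sum>i\<in>UNIV. \<alpha> i) \<le> n} \<subseteq> UNIV \<rightarrow>\<^sub>E {..n}"
    by (simp add: PiE_def Pi_def subset_iff)
  show "finite ((UNIV :: 'd set) \<rightarrow>\<^sub>E {..n})"
    by (intro finite_PiE) simp_all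
qed

abbreviation dim_polys :: "'d::finite itself \<Rightarrow> nat \<Rightarrow> nat" where
  "dim_polys d n \<equiv> (n + CARD('d)) choose CARD('d)"

definition poly_basis :: "nat \<Rightarrow> (nat \<Rightarrow> real^'d \<Rightarrow> real) \<Rightarrow> bool" where
  "poly_basis n p \<longleftrightarrow>
    (let N = dim_polys TYPE('d) n in
      (\<forall>j<N. p j \<in> polys n) \<and>
      (\<forall>c. (\<forall>x. (\<Sum>j<N. c j * p j x) = 0) \<longrightarrow> (\<forall>j<N. c j = 0)) \<and>
      (\<forall>q\<in>polys n. \<exists>c. \<forall>x. q x = (\<Sum>j<N. c j * p j x)))"

definition vdm :: "nat \<Rightarrow> (nat \<Rightarrow> real^'d \<Rightarrow> real) \<Rightarrow> (nat \<Rightarrow> real^'d) \<Rightarrow> real" where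
  "vdm n p x =
    (let N = dim_polys TYPE('d) n in Determinant.det (Matrix.mat N N (\<lambda>(i, j). p j (x i))))"

text \<open>The description below determines a unique polynomial whenever \<^term>\<open>vdm n p x \<noteq> 0\<close>.\<close>

definition lagrange :: "nat \<Rightarrow> (nat \<Rightarrow> real^'d) \<Rightarrow> nat \<Rightarrow> real^'d \<Rightarrow> real" where
  "lagrange n x i =
    (THE l. l \<in> polys n \<and> (\<forall>j < dim_polys TYPE('d) n. l (x j) = (if i = j then 1 else 0)))"

text \<open>The enumeration \<open>x\<close> of \<open>F\<close> does not matter: permuting the points changes \<^const>\<open>vdm\<close> only by a
  sign and permutes the Lagrange polynomials.\<close>

definition fejer_set ::
    "nat \<Rightarrow> (nat \<Rightarrow> real^'d \<Rightarrow> real) \<Rightarrow> (real^'d) set \<Rightarrow> (real^'d) set \<Rightarrow> bool" where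
  "fejer_set n p S F \<longleftrightarrow> F \<subseteq> S \<and>
    (let N = dim_polys TYPE('d) n in
      \<exists>x. bij_betw x {..<N} F \<and> vdm n p x \<noteq> 0 \<and>
          (\<forall>y\<in>S. (\<Sum>i<N. (lagrange n x i y)\<^sup>2) \<le> 1) \<and>
          (\<exists>y\<in>S. (\<Sum>i<N. (lagrange n x i y)\<^sup>2) = 1))"

text \<open>For closed \<open>S\<close> (such as a simplex), the support of a Borel measure is contained in \<open>S\<close> if and
  only if the complement of \<open>S\<close> is a null set.\<close>

definition prob_measures_on :: "(real^'d) set \<Rightarrow> (real^'d) measure set" where
  "prob_measures_on S = {\<mu>. prob_space \<mu> \<and> sets \<mu> = sets borel \<and> emeasure \<mu> (- S) = 0}"

definition gram_matrix ::
    "nat \<Rightarrow> (nat \<Rightarrow> real^'d \<Rightarrow> real) \<Rightarrow> (real^'d) set \<Rightarrow> (real^'d) measure \<Rightarrow> real mat" where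
  "gram_matrix n p S \<mu> =
    (let N = dim_polys TYPE('d) n in Matrix.mat N N (\<lambda>(i, j). LINT x:S|\<mu>. p i x * p j x))"

definition D_optimal ::
    "nat \<Rightarrow> (nat \<Rightarrow> real^'d \<Rightarrow> real) \<Rightarrow> (real^'d) set \<Rightarrow> (real^'d) measure \<Rightarrow> bool" where
  "D_optimal n p S \<mu> \<longleftrightarrow> \<mu> \<in> prob_measures_on S \<and>
    (\<forall>\<nu>\<in>prob_measures_on S.
      Determinant.det (gram_matrix n p S \<nu>) \<le> Determinant.det (gram_matrix n p S \<mu>))"

text \<open>The D-optimal measures are the optimal measures; they coincide with the G-optimal ones by the
  Kiefer--Wolfowitz equivalence theorem.\<close>

abbreviation optimal_measure ::
    "nat \<Rightarrow> (nat \<Rightarrow> real^'d \<Rightarrow> real) \<Rightarrow> (real^'d) set \<Rightarrow> (real^'d) measure \<Rightarrow> bool" where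
  "optimal_measure \<equiv> D_optimal"

text \<open>The Borel measure \<open>\<Sum>a\<in>F. w a \<cdot> \<delta>\<^sub>a\<close>; the Dirac measure \<open>\<delta>\<^sub>a\<close> is \<^term>\<open>return borel a\<close>.\<close>

definition discrete_measure :: "('a::topological_space) set \<Rightarrow> ('a \<Rightarrow> real) \<Rightarrow> 'a measure" where
  "discrete_measure F w =
    measure_of UNIV (sets borel) (\<lambda>A. \<Sum>a\<in>F. ennreal (w a) * emeasure (return borel a) A)"

lemma sets_discrete_measure [simp]: "sets (discrete_measure F w) = sets borel"
  unfolding discrete_measure_def using sets.sets_measure_of_eq[of borel] by simp

lemma emeasure_discrete_measure:
  assumes "A \<in> sets borel"
  shows "emeasure (discrete_measure F w) A = (\<Sum>a\<in>F. ennreal (w a) * emeasure (return borel a) A)"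
proof (rule emeasure_measure_of[OF discrete_measure_def])
  show "countably_additive (sets (discrete_measure F w))
          (\<lambda>A. \<Sum>a\<in>F. ennreal (w a) * emeasure (return borel a) A)"
  proof (rule countably_additiveI)
    fix X :: "nat \<Rightarrow> 'a set"
    assume X: "range X \<subseteq> sets (discrete_measure F w)" "disjoint_family X"
    have *: "(\<Sum>k. emeasure (return borel a) (X k)) = emeasure (return borel a) (\<Union>k. X k)" for a
      using X by (intro suminf_emeasure) simp_all
    have "(\<Sum>k. \<Sum>a\<in>F. ennreal (w a) * emeasure (return borel a) (X k)) =
          (\<Sum>a\<in>F. \<Sum>k. ennreal (w a) * emeasure (return borel a) (X k))"
      by (rule suminf_sum) simp
    also have "\<dots> = (\<Sum>a\<in>F. ennreal (w a) * emeasure (return borel a) (\<Union>k. X k))"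
      by (simp only: ennreal_suminf_cmult *)
    finally show "(\<Sum>k. \<Sum>a\<in>F. ennreal (w a) * emeasure (return borel a) (X k)) =
          (\<Sum>a\<in>F. ennreal (w a) * emeasure (return borel a) (\<Union>k. X k))" .
  qed
qed (use assms in \<open>simp_all add: positive_def\<close>)

end

(*
  Write V for the Vandermonde matrix of an enumeration of F. In the Lagrange basis the Gram
  determinant of a measure nu is vdm^2 * det H with H = [integral of l_i l_j d nu]; for nu = mu
  it is vdm^2 times the product of the weights.

  If F is a Fejer set, H is positive semidefinite of trace at most 1, so AM-GM for its eigenvalues
  gives det H <= N^(-N), the value at the uniform measure on F. Conversely, if mu is optimal, then
  vdm <> 0 because some N points of the simplex are unisolvent, the weights are equal by AM-GM, and
  comparing mu with (1 - t) mu + t delta_y, whose matrix H is a rank-one perturbation of a scalar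
  matrix, gives sum_i l_i(y)^2 <= 1 as t -> 0. At the points of F this sum is 1.
*)

theory Submission
  imports Defs "Jordan_Normal_Form.Schur_Decomposition"
begin

subsection \<open>Determinants\<close>

lemma index_triple_prod_mat:
  assumes "A \<in> carrier_mat n n" "B \<in> carrier_mat n n" "C \<in> carrier_mat n n" "i < n" "j < n"
  shows "(A * B * C) $$ (i, j) = (\<Sum>k<n. \<Sum>l<n. A $$ (i, k) * B $$ (k, l) * C $$ (l, j))"
proof -
  have "(A * B * C) $$ (i, j) = (\<Sum>l<n. (\<Sum>k<n. A $$ (i, k) * B $$ (k, l)) * C $$ (l, j))"
    using assms
    by (auto simp: scalar_prod_def atLeast0LessThan simp del: assoc_mult_mat intro!: sum.cong)
  also have "\<dots> = (\<Sum>k<n. \<Sum>l<n. A $$ (i, k) * B $$ (k, l) * C $$ (l, j))"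
    by (subst sum.swap) (simp add: sum_distrib_right)
  finally show ?thesis .
qed

text \<open>Cycling the factors of \<open>P * B * Q\<close> inside the trace, done here entry by
  entry, brings \<open>Q * P = 1\<close> together. This lets the trace be read off a triangular
  form.\<close>

lemma trace_similar_mat:
  fixes A :: "'a :: comm_ring_1 mat"
  assumes "A \<in> carrier_mat n n" "similar_mat A B"
  shows "(\<Sum>i<n. A $$ (i, i)) = (\<Sum>i<n. B $$ (i, i))"
proof -
  from similar_matD[OF assms(2)] obtain m P Q where
    c: "{A, B, P, Q} \<subseteq> carrier_mat m m" and QP: "Q * P = 1\<^sub>m m" and A: "A = P * B * Q"
    by blast
  have [simp]: "m = n"
    using c assms(1) by auto
  have c': "P \<in> carrier_mat n n" "B \<in> carrier_mat n n" "Q \<in> carrier_mat n n"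
    using c by auto
  have QP': "(\<Sum>i<n. Q $$ (l, i) * P $$ (i, k)) = (if l = k then 1 else 0)" if "l < n" "k < n" for l k
  proof -
    have "(\<Sum>i<n. Q $$ (l, i) * P $$ (i, k)) = (Q * P) $$ (l, k)"
      using c' that by (auto simp: scalar_prod_def atLeast0LessThan intro!: sum.cong)
    then show ?thesis
      using QP that by simp
  qed
  have "(\<Sum>i<n. A $$ (i, i)) = (\<Sum>i<n. \<Sum>k<n. \<Sum>l<n. P $$ (i, k) * B $$ (k, l) * Q $$ (l, i))"
    unfolding A by (intro sum.cong refl index_triple_prod_mat c') auto
  also have "\<dots> = (\<Sum>k<n. \<Sum>l<n. \<Sum>i<n. P $$ (i, k) * B $$ (k, l) * Q $$ (l, i))"
    by (subst sum.swap, rule sum.cong[OF refl], subst sum.swap, simp)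
  also have "\<dots> = (\<Sum>k<n. \<Sum>l<n. B $$ (k, l) * (\<Sum>i<n. Q $$ (l, i) * P $$ (i, k)))"
    unfolding sum_distrib_left by (intro sum.cong refl) (simp add: mult_ac)
  also have "\<dots> = (\<Sum>k<n. B $$ (k, k))"
  proof (rule sum.cong[OF refl])
    fix k assume k: "k \<in> {..<n}"
    then have "(\<Sum>l<n. B $$ (k, l) * (\<Sum>i<n. Q $$ (l, i) * P $$ (i, k))) =
        (\<Sum>l<n. if l = k then B $$ (k, l) else 0)"
      by (intro sum.cong) (auto simp: QP')
    then show "(\<Sum>l<n. B $$ (k, l) * (\<Sum>i<n. Q $$ (l, i) * P $$ (i, k))) = B $$ (k, k)"
      using k by simp
  qed
  finally show ?thesis .
qed

text \<open>For an eigenvector f = a + i b the Hermitian form of f is k |f|^2. Since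
  \<open>psd\<close> speaks of real vectors only, the form is split: its real part is the sum of the
  real forms at a and b, and its imaginary part consists of two mixed terms that cancel by
  symmetry.\<close>

lemma eigenvalue_psd_mat:
  fixes A :: "real mat" and k :: complex
  assumes A: "A \<in> carrier_mat n n"
    and sym: "\<And>i j. i < n \<Longrightarrow> j < n \<Longrightarrow> A $$ (i, j) = A $$ (j, i)"
    and psd: "\<And>v. 0 \<le> (\<Sum>i<n. \<Sum>j<n. v i * A $$ (i, j) * v j)"
    and k: "eigenvalue (map_mat complex_of_real A) k"
  shows "k \<in> \<real> \<and> 0 \<le> Re k"
proof -
  from k obtain v where v: "v \<in> carrier_vec n" "v \<noteq> 0\<^sub>v n"
    and Av: "map_mat complex_of_real A *\<^sub>v v = k \<cdot>\<^sub>v v"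
    using A unfolding eigenvalue_def eigenvector_def by auto
  define f where "f i = vec_index v i" for i
  have Avi: "(\<Sum>j<n. of_real (A $$ (i, j)) * f j) = k * f i" if "i < n" for i
    using arg_cong[OF Av, of "\<lambda>w. vec_index w i"] A v that
    by (simp add: scalar_prod_def atLeast0LessThan f_def)
  define s where "s = (\<Sum>i<n. (cmod (f i))\<^sup>2)"
  obtain i0 where i0: "i0 < n" "f i0 \<noteq> 0"
    using v unfolding f_def by (metis eq_vecI carrier_vecD index_zero_vec)
  then have s: "s > 0"
    unfolding s_def by (intro sum_pos2[of _ i0]) auto
  define R where "R g h = (\<Sum>i<n. \<Sum>j<n. g i * A $$ (i, j) * h j)" for g h
  have R_sym: "R g h = R h g" for g h
    unfolding R_def by (subst sum.swap) (auto intro!: sum.cong simp: sym)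
  define a b where "a i = Re (f i)" and "b i = Im (f i)" for i
  have "k * of_real s = (\<Sum>i<n. cnj (f i) * (k * f i))"
    unfolding s_def of_real_sum sum_distrib_left
    by (rule sum.cong) (simp_all add: complex_norm_square mult_ac del: of_real_power)
  also have "\<dots> = (\<Sum>i<n. \<Sum>j<n. cnj (f i) * (of_real (A $$ (i, j)) * f j))"
    by (simp add: Avi[symmetric] sum_distrib_left)
  finally have eq: "k * of_real s = (\<Sum>i<n. \<Sum>j<n. cnj (f i) * (of_real (A $$ (i, j)) * f j))" .
  have "Re k * s = R a a + R b b"
    using arg_cong[OF eq, of Re]
    by (simp add: R_def a_def b_def distrib_left sum.distrib mult.assoc mult.left_commute)
  moreover have "Im k * s = R a b - R b a"
    using arg_cong[OF eq, of Im]
    by (simp add: R_def a_def b_def right_diff_distrib sum_subtractf mult.assoc mult.left_commute)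
  ultimately have "Im k * s = 0" "0 \<le> Re k * s"
    using psd[of a] psd[of b] R_sym[of a b] by (simp_all add: R_def)
  then show ?thesis
    using s by (simp add: complex_is_Real_iff zero_le_mult_iff)
qed

text \<open>The determinant is the product of the eigenvalues, which are nonnegative, and each
  factor r satisfies r <= exp (r - 1). This replaces AM-GM: for trace at most n the bound is at most
  1.\<close>

lemma det_psd_le_exp_trace:
  fixes A :: "real mat"
  assumes A: "A \<in> carrier_mat n n"
    and sym: "\<And>i j. i < n \<Longrightarrow> j < n \<Longrightarrow> A $$ (i, j) = A $$ (j, i)"
    and psd: "\<And>v. 0 \<le> (\<Sum>i<n. \<Sum>j<n. v i * A $$ (i, j) * v j)"
  shows "Determinant.det A \<le> exp ((\<Sum>i<n. A $$ (i, i)) - real n)"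
proof -
  define C where "C = map_mat complex_of_real A"
  have C: "C \<in> carrier_mat n n"
    using A by (simp add: C_def)
  \<comment> \<open>Over the complex numbers the characteristic polynomial splits, so
    \<open>C\<close> is similar to an upper triangular \<open>B\<close> whose diagonal entries are
    the eigenvalues.\<close>
  obtain es where es: "char_poly C = (\<Prod>a\<leftarrow>es. [:- a, 1:])"
    using char_poly_factorized[OF C] by blast
  obtain B where B: "B \<in> carrier_mat n n" "upper_triangular B" "similar_mat C B"
    using schur_decomposition_exists[OF C es] by blast
  define l where "l i = B $$ (i, i)" for i
  have l: "l i = of_real (Re (l i)) \<and> 0 \<le> Re (l i)" if "i < n" for i
  proof -
    have "poly (char_poly B) (l i) = 0"
      unfolding char_poly_upper_triangular[OF B(1,2)]
      using B(1) that by (auto simp: poly_prod_list l_def diag_mat_def prod_list_zero_iff image_iff)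
    then have "eigenvalue C (l i)"
      using eigenvalue_root_char_poly[OF C] char_poly_similar[OF B(3)] by simp
    then show ?thesis
      using eigenvalue_psd_mat[OF A sym psd] unfolding C_def by (auto simp: of_real_Re)
  qed
  have "complex_of_real (Determinant.det A) = Determinant.det C"
    by (simp add: C_def of_real_hom.hom_det)
  also have "\<dots> = (\<Prod>i<n. l i)"
    unfolding det_similar[OF B(3)] det_upper_triangular[OF B(2,1)]
    using B(1) by (simp add: diag_mat_def l_def prod.list_conv_set_nth atLeast0LessThan)
  also have "\<dots> = of_real (\<Prod>i<n. Re (l i))"
    unfolding of_real_prod using l by (intro prod.cong) auto
  finally have det: "Determinant.det A = (\<Prod>i<n. Re (l i))"
    by (simp only: of_real_eq_iff)
  have "complex_of_real (\<Sum>i<n. A $$ (i, i)) = (\<Sum>i<n. C $$ (i, i))"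
    using A by (simp add: C_def)
  also have "\<dots> = (\<Sum>i<n. l i)"
    unfolding l_def by (rule trace_similar_mat[OF C B(3)])
  finally have tr: "(\<Sum>i<n. A $$ (i, i)) = (\<Sum>i<n. Re (l i))"
    by (metis Re_complex_of_real Re_sum)
  have "(\<Prod>i<n. Re (l i)) \<le> (\<Prod>i<n. exp (Re (l i) - 1))"
    using l exp_ge_add_one_self[of "Re (l _) - 1"] by (intro prod_mono) auto
  also have "\<dots> = exp ((\<Sum>i<n. Re (l i)) - real n)"
    by (simp add: exp_sum[symmetric] sum_subtractf)
  finally show ?thesis
    by (simp add: det tr)
qed

section \<open>Diagonal matrices and rank-one perturbations of scalar matrices\<close>

lemma det_diagonal_mat:
  "Determinant.det (Matrix.mat n n (\<lambda>(i, j). if i = j then u i else 0)) = (\<Prod>i<n. u i)"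
proof -
  have "upper_triangular (Matrix.mat n n (\<lambda>(i, j). if i = j then u i else 0))"
    by (auto simp: upper_triangular_def)
  from det_upper_triangular[OF this, of n] show ?thesis
    by (simp add: diag_mat_def prod.list_conv_set_nth atLeast0LessThan)
qed

text \<open>The bordered matrix \<open>X\<close> is reduced to block triangular form in two ways by
  factors of determinant 1. Column operations \<open>Y\<close> use the corner 1 to clear the last
  row and leave \<open>?M\<close> in the large block; row operations \<open>Z\<close> use
  \<open>D\<close>, invertible as \<open>a\<close> is nonzero, and leave the scalar factor in the
  corner.\<close>

lemma det_scalar_plus_rank_one:
  fixes a b :: real
  assumes a: "a \<noteq> 0"
  shows "Determinant.det (Matrix.mat n n (\<lambda>(i, j). (if i = j then a else 0) + b * (v i * v j)))
    = a ^ n * (1 + b / a * (\<Sum>i<n. (v i)\<^sup>2))" (is "Determinant.det ?M = _")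
proof -
  define D where "D = Matrix.mat n n (\<lambda>(i, j). if i = j then a else 0)"
  define c where "c = Matrix.mat n 1 (\<lambda>(i, j). - b * v i)"
  define r where "r = Matrix.mat 1 n (\<lambda>(i, j). v j)"
  define r' where "r' = Matrix.mat 1 n (\<lambda>(i, j). - v j)"
  define r'' where "r'' = Matrix.mat 1 n (\<lambda>(i, j). - v j / a)"
  have carr: "D \<in> carrier_mat n n" "c \<in> carrier_mat n 1" "r \<in> carrier_mat 1 n"
    "r' \<in> carrier_mat 1 n" "r'' \<in> carrier_mat 1 n"
    by (auto simp: D_def c_def r_def r'_def r''_def)
  define X where "X = four_block_mat D c r (1\<^sub>m 1)"
  define Y where "Y = four_block_mat (1\<^sub>m n) (0\<^sub>m n 1) r' (1\<^sub>m 1)"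
  define Z where "Z = four_block_mat (1\<^sub>m n) (0\<^sub>m n 1) r'' (1\<^sub>m 1)"
  define s where "s = Matrix.mat 1 1 (\<lambda>_. 1 + b / a * (\<Sum>i<n. (v i)\<^sup>2))"
  have cXYZ: "X \<in> carrier_mat (n+1) (n+1)" "Y \<in> carrier_mat (n+1) (n+1)" "Z \<in> carrier_mat (n+1) (n+1)"
    using carr by (auto simp: X_def Y_def Z_def)
  have detY: "Determinant.det Y = 1" and detZ: "Determinant.det Z = 1"
    unfolding Y_def Z_def using carr
    by (auto simp: det_four_block_mat_upper_right_zero[where n = n and m = 1])
  have "D + c * r' = ?M"
    by (rule eq_matI) (auto simp: D_def c_def r'_def scalar_prod_def)
  moreover have "r + r' = 0\<^sub>m 1 n"
    by (rule eq_matI) (auto simp: r_def r'_def)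
  ultimately have XY: "X * Y = four_block_mat ?M c (0\<^sub>m 1 n) (1\<^sub>m 1)"
    unfolding X_def Y_def using carr
    by (subst mult_four_block_mat[of _ n n _ 1 _ 1 _ _ n _ 1]) auto
  have "r'' * D + r = 0\<^sub>m 1 n"
    using a by (intro eq_matI)
      (auto simp: r_def r''_def D_def scalar_prod_def if_distrib sum.If_cases cong: if_cong)
  moreover have "r'' * c + 1\<^sub>m 1 = s"
    by (intro eq_matI)
      (auto simp: r''_def c_def s_def scalar_prod_def sum_distrib_left power2_eq_square
        atLeast0LessThan mult_ac)
  ultimately have ZX: "Z * X = four_block_mat D c (0\<^sub>m 1 n) s"
    unfolding X_def Z_def using carr
    by (subst mult_four_block_mat[of _ n n _ 1 _ 1 _ _ n _ 1]) auto
  have "Determinant.det ?M = Determinant.det (X * Y)"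
    unfolding XY using carr
    by (subst det_four_block_mat_lower_left_zero[where n = n and m = 1]) auto
  also have "\<dots> = Determinant.det (Z * X)"
    by (simp add: det_mult[OF cXYZ(1,2)] det_mult[OF cXYZ(3,1)] detY detZ)
  also have "\<dots> = Determinant.det D * Determinant.det s"
    unfolding ZX using carr
    by (subst det_four_block_mat_lower_left_zero[where n = n and m = 1]) (auto simp: s_def)
  also have "\<dots> = a ^ n * (1 + b / a * (\<Sum>i<n. (v i)\<^sup>2))"
    unfolding D_def det_diagonal_mat by (simp add: s_def det_single)
  finally show ?thesis .
qed

subsection \<open>Polynomials and Lagrange interpolation\<close>

lemma polys_lincomb:
  assumes "\<And>j. j \<in> J \<Longrightarrow> q j \<in> polys n"
  shows "(\<lambda>x. \<Sum>j\<in>J. c j * q j x) \<in> polys n"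
proof -
  let ?m = "\<lambda>\<alpha> x. \<Prod>i\<in>UNIV. vec_nth x i ^ \<alpha> i"
  have "\<exists>a. \<forall>j\<in>J. q j = (\<lambda>x. \<Sum>\<alpha> | (\<Sum>i\<in>UNIV. \<alpha> i) \<le> n. a j \<alpha> * ?m \<alpha> x)"
    using assms by (intro bchoice) (simp add: polys_def)
  then obtain a where a: "q j = (\<lambda>x. \<Sum>\<alpha> | (\<Sum>i\<in>UNIV. \<alpha> i) \<le> n. a j \<alpha> * ?m \<alpha> x)" if "j \<in> J" for j
    by (elim exE) (rule that, rule bspec)
  have eq: "(\<Sum>j\<in>J. c j * q j x) =
    (\<Sum>\<alpha> | (\<Sum>i\<in>UNIV. \<alpha> i) \<le> n. (\<Sum>j\<in>J. c j * a j \<alpha>) * (\<Prod>i\<in>UNIV. vec_nth x i ^ \<alpha> i))" for x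
  proof -
    have "(\<Sum>j\<in>J. c j * q j x) =
      (\<Sum>j\<in>J. \<Sum>\<alpha> | (\<Sum>i\<in>UNIV. \<alpha> i) \<le> n. c j * a j \<alpha> * (\<Prod>i\<in>UNIV. vec_nth x i ^ \<alpha> i))"
      by (intro sum.cong refl) (simp only: a sum_distrib_left mult.assoc)
    then show ?thesis
      by (subst (asm) sum.swap) (simp only: sum_distrib_right)
  qed
  show ?thesis
    unfolding polys_def eq by (rule CollectI, rule exI, rule refl)
qed

lemma polys_diff:
  assumes "q \<in> polys n" "r \<in> polys n"
  shows "(\<lambda>x. q x - r x) \<in> polys n"
  using polys_lincomb[of UNIV "\<lambda>b. if b then q else r" n "\<lambda>b. if b then 1 else -1"] assms
  by (simp add: UNIV_bool algebra_simps)

lemma continuous_on_polys: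
  assumes "q \<in> polys n"
  shows "continuous_on A q"
  using assms unfolding polys_def by (auto intro!: continuous_intros)

lemma borel_measurable_polys:
  assumes "q \<in> polys n"
  shows "q \<in> borel_measurable borel"
  using continuous_on_polys[OF assms] by (rule borel_measurable_continuous_onI)

text \<open>Reduces questions about zeros in several variables to a univariate polynomial, obtained
  by substituting a linear polynomial for each coordinate.\<close>

lemma polys_along_line:
  assumes "q \<in> polys n"
  obtains P where "\<And>t. poly P t = q (z + t *\<^sub>R u)"
proof -
  from assms obtain c where q:
    "q = (\<lambda>x. \<Sum>\<alpha> | (\<Sum>i\<in>UNIV. \<alpha> i) \<le> n. c \<alpha> * (\<Prod>i\<in>UNIV. vec_nth x i ^ \<alpha> i))"
    unfolding polys_def by blast
  define P where "P = (\<Sum>\<alpha> | (\<Sum>i\<in>UNIV. \<alpha> i) \<le> n.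
    Polynomial.smult (c \<alpha>) (\<Prod>i\<in>UNIV. [:vec_nth z i, vec_nth u i:] ^ \<alpha> i))"
  have "poly P t = q (z + t *\<^sub>R u)" for t
    by (simp add: P_def q poly_sum poly_prod)
  then show ?thesis
    using that by blast
qed

text \<open>On the line from an interior point \<open>z\<close> of \<open>S\<close> to
  \<open>y\<close>, the polynomial vanishes for all small positive t. A univariate polynomial with
  infinitely many roots is zero, and its value at t = 1 is \<open>q y\<close>.\<close>

lemma polys_eq_0:
  assumes q: "q \<in> polys n" and S: "interior S \<noteq> {}" and 0: "\<And>x. x \<in> S \<Longrightarrow> q x = 0"
  shows "q y = 0"
proof -
  obtain z e where e: "e > 0" "ball z e \<subseteq> S"
    using S by (meson ex_in_conv mem_interior)
  obtain P where P: "\<And>t. poly P t = q (z + t *\<^sub>R (y - z))"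
    using polys_along_line[OF q] by blast
  \<comment> \<open>The summand 1 keeps the denominator positive when \<open>y = z\<close>.\<close>
  define d where "d = e / (norm (y - z) + 1)"
  have d: "d > 0"
    using e by (simp add: d_def add_nonneg_pos)
  have "poly P t = 0" if t: "0 < t" "t < d" for t
  proof -
    have "t * norm (y - z) \<le> t * (norm (y - z) + 1)"
      using t by (intro mult_left_mono) auto
    also have "\<dots> < e"
      using t by (simp add: d_def pos_less_divide_eq add_nonneg_pos)
    finally have "z + t *\<^sub>R (y - z) \<in> ball z e"
      using t by (simp add: dist_norm)
    then show ?thesis
      using e(2) 0 by (auto simp: P)
  qed
  then have "{0<..<d} \<subseteq> {t. poly P t = 0}"
    by auto
  moreover have "infinite {0<..<d}"
    using d by simp
  ultimately have "P = 0"
    using poly_roots_finite[of P] finite_subset by blast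
  then show ?thesis
    using P[of 1] by simp
qed

text \<open>Points are added one at a time: expanding the next determinant along the row of its new
  point gives a nontrivial linear combination of the basis, which cannot vanish on all of \<open>S\<close>.\<close>

lemma exists_vdm_ne_0:
  fixes S :: "(real^'d) set"
  assumes basis: "poly_basis n p" and S: "interior S \<noteq> {}"
  obtains z where "\<And>i. z i \<in> S" "vdm n p z \<noteq> 0"
proof -
  let ?N = "dim_polys TYPE('d) n"
  obtain s0 where s0: "s0 \<in> S"
    using S interior_subset by blast
  have "k \<le> ?N \<Longrightarrow>
    \<exists>z. (\<forall>i. z i \<in> S) \<and> Determinant.det (Matrix.mat k k (\<lambda>(i, j). p j (z i))) \<noteq> 0" for k
  proof (induction k)
    case 0
    then show ?case
      \<comment> \<open>The determinant of the empty matrix is 1, so any sequence in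
        \<open>S\<close> starts the induction.\<close>
      using s0 by (intro exI[of _ "\<lambda>_. s0"]) simp
  next
    case (Suc k)
    then obtain z where z: "\<And>i. z i \<in> S" and
      det: "Determinant.det (Matrix.mat k k (\<lambda>(i, j). p j (z i))) \<noteq> 0"
      by auto
    define M where "M y = Matrix.mat (Suc k) (Suc k) (\<lambda>(i, j). p j ((z(k := y)) i))" for y
    \<comment> \<open>These cofactors delete row \<open>k\<close>, the only row that contains the
      new point, so \<open>s0\<close> is a mere placeholder.\<close>
    define c where "c j = cofactor (M s0) k j" for j
    have del: "mat_delete (M y) k j = mat_delete (M s0) k j" for y j
      by (rule eq_matI) (auto simp: M_def mat_delete_def)
    have det_M: "Determinant.det (M y) = (\<Sum>j<Suc k. c j * p j y)" for y
    proof -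
      have "Determinant.det (M y) = (\<Sum>j<Suc k. M y $$ (k, j) * cofactor (M y) k j)"
        by (rule laplace_expansion_row) (auto simp: M_def)
      also have "\<dots> = (\<Sum>j<Suc k. c j * p j y)"
        by (intro sum.cong refl) (simp add: c_def cofactor_def del[of y], simp add: M_def)
      finally show ?thesis .
    qed
    \<comment> \<open>The last coefficient is the previous determinant; this is where the induction
      hypothesis makes the combination nontrivial.\<close>
    have "mat_delete (M s0) k k = Matrix.mat k k (\<lambda>(i, j). p j (z i))"
      by (rule eq_matI) (auto simp: M_def mat_delete_def)
    with det have ck: "c k \<noteq> 0"
      by (simp add: c_def cofactor_def)
    have "\<exists>y\<in>S. Determinant.det (M y) \<noteq> 0"
    proof (rule ccontr)
      assume "\<not> ?thesis"
      then have vanish: "\<And>x. x \<in> S \<Longrightarrow> (\<Sum>j<Suc k. c j * p j x) = 0"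
        by (auto simp: det_M)
      have "(\<lambda>x. \<Sum>j<Suc k. c j * p j x) \<in> polys n"
        using basis Suc.prems by (intro polys_lincomb) (auto simp: poly_basis_def Let_def)
      note * = polys_eq_0[OF this S vanish]
      have indep: "\<And>a. \<forall>x. (\<Sum>j<?N. a j * p j x) = 0 \<Longrightarrow> \<forall>j<?N. a j = 0"
        using basis by (simp add: poly_basis_def Let_def)
      \<comment> \<open>Linear independence is stated for all \<open>?N\<close> basis elements, so
        \<open>c\<close> is extended by zero.\<close>
      have "(\<Sum>j<?N. (if j < Suc k then c j else 0) * p j x) = (\<Sum>j<Suc k. c j * p j x)" for x
        using Suc.prems by (intro sum.mono_neutral_cong_right) auto
      then have "\<forall>x. (\<Sum>j<?N. (if j < Suc k then c j else 0) * p j x) = 0"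
        using * by simp
      from indep[OF this] have "\<forall>j<?N. (if j < Suc k then c j else 0) = 0" .
      then have "(if k < Suc k then c k else 0) = 0"
        using Suc.prems by (meson Suc_le_lessD)
      then show False
        using ck by simp
    qed
    then obtain y where "y \<in> S" "Determinant.det (M y) \<noteq> 0"
      by blast
    then show ?case
      using z unfolding M_def by (intro exI[of _ "z(k := y)"]) auto
  qed
  then show ?thesis
    using that unfolding vdm_def Let_def by blast
qed

section \<open>Lagrange interpolation at nodes with nonzero Vandermonde determinant\<close>

context
  fixes n :: nat and p :: "nat \<Rightarrow> real^'d \<Rightarrow> real" and x :: "nat \<Rightarrow> real^'d" and N :: nat
  assumes basis: "poly_basis n p" and vdm: "vdm n p x \<noteq> 0"
  defines "N \<equiv> dim_polys TYPE('d) n"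
begin

text \<open>The coefficient vector of \<open>q - r\<close> in the basis lies in the kernel of the
  Vandermonde matrix, which is trivial.\<close>

lemma polys_eqI_nodes:
  assumes q: "q \<in> polys n" and r: "r \<in> polys n" and eq: "\<And>i. i < N \<Longrightarrow> q (x i) = r (x i)"
  shows "q = r"
proof
  fix y
  let ?V = "Matrix.mat N N (\<lambda>(i, j). p j (x i))"
  have spanning: "\<forall>q\<in>polys n. \<exists>c. \<forall>y. q y = (\<Sum>j<N. c j * p j y)"
    using basis by (simp add: poly_basis_def N_def Let_def)
  obtain c where c: "\<And>y. q y - r y = (\<Sum>j<N. c j * p j y)"
    using bspec[OF spanning polys_diff[OF q r]] by blast
  define v where "v = Matrix.vec N c"
  have "?V *\<^sub>v v = 0\<^sub>v N"
  proof (rule eq_vecI)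
    fix i assume "i < dim_vec (0\<^sub>v N :: real Matrix.vec)"
    then have i: "i < N"
      by simp
    then have "vec_index (?V *\<^sub>v v) i = (\<Sum>j<N. c j * p j (x i))"
      by (simp add: v_def scalar_prod_def atLeast0LessThan mult.commute)
    then show "vec_index (?V *\<^sub>v v) i = vec_index (0\<^sub>v N) i"
      using eq[OF i] i by (simp add: c[symmetric])
  qed simp
  moreover have "Determinant.det ?V \<noteq> 0"
    using vdm by (simp add: vdm_def N_def Let_def)
  moreover have "v \<in> carrier_vec N"
    by (simp add: v_def)
  ultimately have v0: "v = 0\<^sub>v N"
    using det_0_iff_vec_prod_zero_field[of ?V N] by auto
  have "c j = 0" if "j < N" for j
    using arg_cong[OF v0, of "\<lambda>v. vec_index v j"] that by (simp add: v_def)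
  then show "q y = r y"
    using c[of y] by simp
qed

text \<open>Column \<open>i\<close> of the inverse Vandermonde matrix holds the coefficients of the
  i-th Lagrange polynomial.\<close>

lemma lagrange_exists:
  assumes i: "i < N"
  shows "\<exists>l\<in>polys n. \<forall>j<N. l (x j) = (if i = j then 1 else 0)"
proof -
  let ?V = "Matrix.mat N N (\<lambda>(i, j). p j (x i))"
  have V: "?V \<in> carrier_mat N N"
    by simp
  have "Determinant.det ?V \<noteq> 0"
    using vdm by (simp add: vdm_def N_def Let_def)
  then obtain B where B: "B \<in> carrier_mat N N" and VB: "?V * B = 1\<^sub>m N"
    using det_non_zero_imp_unit[OF V] unfolding Units_def ring_mat_def by auto
  have "(\<Sum>k<N. B $$ (k, i) * p k (x j)) = (if i = j then 1 else 0)" if "j < N" for j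
  proof -
    have "(\<Sum>k<N. B $$ (k, i) * p k (x j)) = (?V * B) $$ (j, i)"
      using B i that by (simp add: scalar_prod_def atLeast0LessThan mult.commute)
    then show ?thesis
      using i that by (simp add: VB)
  qed
  moreover have "(\<lambda>y. \<Sum>k<N. B $$ (k, i) * p k y) \<in> polys n"
    using basis by (intro polys_lincomb) (auto simp: poly_basis_def N_def Let_def)
  ultimately show ?thesis
    by (intro bexI[of _ "\<lambda>y. \<Sum>k<N. B $$ (k, i) * p k y"]) auto
qed

text \<open>Existence together with uniqueness on the nodes makes the definite description in
  \<open>lagrange\<close> meaningful.\<close>

lemma lagrange_polys: "i < N \<Longrightarrow> lagrange n x i \<in> polys n"
  and lagrange_node: "i < N \<Longrightarrow> j < N \<Longrightarrow> lagrange n x i (x j) = (if i = j then 1 else 0)"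
proof -
  assume i: "i < N"
  have "\<exists>!l. l \<in> polys n \<and> (\<forall>j<N. l (x j) = (if i = j then 1 else 0))"
    using lagrange_exists[OF i] by (auto intro!: ex_ex1I polys_eqI_nodes)
  from theI'[OF this]
  have *: "lagrange n x i \<in> polys n \<and> (\<forall>j<N. lagrange n x i (x j) = (if i = j then 1 else 0))"
    unfolding lagrange_def N_def .
  then show "lagrange n x i \<in> polys n"
    by blast
  show "j < N \<Longrightarrow> lagrange n x i (x j) = (if i = j then 1 else 0)"
    using * by blast
qed

lemma lagrange_interpolation:
  assumes q: "q \<in> polys n"
  shows "q y = (\<Sum>i<N. q (x i) * lagrange n x i y)"
proof -
  have "q = (\<lambda>y. \<Sum>i<N. q (x i) * lagrange n x i y)"
  proof (rule polys_eqI_nodes[OF q])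
    show "(\<lambda>y. \<Sum>i<N. q (x i) * lagrange n x i y) \<in> polys n"
      by (intro polys_lincomb lagrange_polys) simp
    fix j assume j: "j < N"
    then have "(\<Sum>i<N. q (x i) * lagrange n x i (x j)) = (\<Sum>i<N. if i = j then q (x i) else 0)"
      by (intro sum.cong) (auto simp: lagrange_node)
    then show "q (x j) = (\<Sum>i<N. q (x i) * lagrange n x i (x j))"
      using j by simp
  qed
  then show ?thesis
    by (rule fun_cong)
qed

end

subsection \<open>Gram matrices\<close>

text \<open>A continuous function is bounded on the compact set \<open>S\<close> and the measure is
  finite. Hence the Gram integrals are genuine, not the default value 0 of a non-integrable
  function.\<close>

lemma set_integrable_compact_prob:
  fixes f :: "real^'d \<Rightarrow> real"
  assumes M: "M \<in> prob_measures_on S" and S: "compact S" and f: "continuous_on UNIV f"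
  shows "set_integrable M S f"
proof -
  have sets: "sets M = sets borel" and "prob_space M"
    using M by (auto simp: prob_measures_on_def)
  interpret prob_space M by fact
  have "continuous_on S f"
    using f continuous_on_subset by blast
  then obtain B where B: "norm (f x) \<le> B" if "x \<in> S" for x
    using compact_continuous_image[OF _ S] compact_imp_bounded
    by (metis bounded_iff imageI)
  have "S \<in> sets M"
    using S sets by (simp add: borel_compact)
  moreover have "f \<in> borel_measurable M"
    unfolding measurable_cong_sets[OF sets refl] by (rule borel_measurable_continuous_onI[OF f])
  moreover have "AE x in M. x \<in> S \<longrightarrow> norm (f x) \<le> B"
    using B by (intro AE_I2 impI)
  ultimately show ?thesis
    unfolding set_integrable_def
    by (intro integrableI_bounded_set_indicator) (simp_all add: emeasure_finite less_top[symmetric])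
qed

lemma gram_matrix_carrier:
  fixes q :: "nat \<Rightarrow> real^'d \<Rightarrow> real"
  shows "gram_matrix n q S M \<in> carrier_mat (dim_polys TYPE('d) n) (dim_polys TYPE('d) n)"
  by (simp add: gram_matrix_def Let_def)

lemma gram_matrix_index:
  fixes q :: "nat \<Rightarrow> real^'d \<Rightarrow> real"
  assumes "i < dim_polys TYPE('d) n" "j < dim_polys TYPE('d) n"
  shows "gram_matrix n q S M $$ (i, j) = (LINT y:S|M. q i y * q j y)"
  using assms by (simp add: gram_matrix_def Let_def)

text \<open>Serves two purposes: with general \<open>a\<close> and \<open>b\<close> it gives the
  change of basis, and with \<open>a = b\<close> the integrand is a square, which gives positive
  semidefiniteness.\<close>

lemma gram_matrix_bilinear:
  fixes q :: "nat \<Rightarrow> real^'d \<Rightarrow> real" and n :: nat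
  defines "N \<equiv> dim_polys TYPE('d) n"
  assumes M: "M \<in> prob_measures_on S" and S: "compact S"
    and q: "\<And>i. i < N \<Longrightarrow> continuous_on UNIV (q i)"
  shows "(\<Sum>i<N. \<Sum>j<N. a i * gram_matrix n q S M $$ (i, j) * b j) =
    (LINT y:S|M. (\<Sum>i<N. a i * q i y) * (\<Sum>j<N. b j * q j y))"
proof -
  have int: "set_integrable M S (\<lambda>y. a i * b j * (q i y * q j y))" if "i < N" "j < N" for i j
    using that by (intro set_integrable_compact_prob[OF M S] continuous_intros q)
  have "(LINT y:S|M. (\<Sum>i<N. a i * q i y) * (\<Sum>j<N. b j * q j y)) =
      (LINT y|M. (\<Sum>i<N. \<Sum>j<N. indicator S y *\<^sub>R (a i * b j * (q i y * q j y))))"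
    unfolding set_lebesgue_integral_def sum_product scaleR_sum_right
    by (simp add: mult_ac)
  also have "\<dots> = (\<Sum>i<N. LINT y|M. (\<Sum>j<N. indicator S y *\<^sub>R (a i * b j * (q i y * q j y))))"
    by (intro Bochner_Integration.integral_sum Bochner_Integration.integrable_sum int[unfolded set_integrable_def]) auto
  also have "\<dots> = (\<Sum>i<N. \<Sum>j<N. (LINT y:S|M. a i * b j * (q i y * q j y)))"
    unfolding set_lebesgue_integral_def
    by (intro sum.cong refl Bochner_Integration.integral_sum int[unfolded set_integrable_def]) auto
  also have "\<dots> = (\<Sum>i<N. \<Sum>j<N. a i * gram_matrix n q S M $$ (i, j) * b j)"
    by (intro sum.cong refl) (simp add: gram_matrix_index N_def)
  finally show ?thesis ..
qed

text \<open>Interpolation writes \<open>p i\<close> in the Lagrange basis with coefficients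
  \<open>p i (x k)\<close>, the entries of the Vandermonde matrix V. So the Gram matrix is V^T H V
  with H the Gram matrix of the Lagrange polynomials.\<close>

lemma det_gram_matrix_lagrange:
  fixes S :: "(real^'d) set"
  assumes basis: "poly_basis n p" and vdm: "vdm n p x \<noteq> 0"
    and M: "M \<in> prob_measures_on S" and S: "compact S"
  shows "Determinant.det (gram_matrix n p S M) =
    (vdm n p x)\<^sup>2 * Determinant.det (gram_matrix n (lagrange n x) S M)"
proof -
  let ?N = "dim_polys TYPE('d) n"
  let ?V = "Matrix.mat ?N ?N (\<lambda>(i, j). p j (x i))"
  let ?G = "gram_matrix n (lagrange n x) S M"
  have V: "?V \<in> carrier_mat ?N ?N" "transpose_mat ?V \<in> carrier_mat ?N ?N"
    by auto
  note G = gram_matrix_carrier[of n "lagrange n x" S M]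
  have cont: "continuous_on UNIV (lagrange n x i)" if "i < ?N" for i
    using lagrange_polys[OF basis vdm that] by (rule continuous_on_polys)
  have p: "p i y = (\<Sum>k<?N. p i (x k) * lagrange n x k y)" if "i < ?N" for i y
    using basis that by (intro lagrange_interpolation[OF basis vdm]) (simp add: poly_basis_def Let_def)
  have "gram_matrix n p S M = transpose_mat ?V * ?G * ?V"
  proof (rule eq_matI)
    fix i j assume "i < dim_row (transpose_mat ?V * ?G * ?V)" "j < dim_col (transpose_mat ?V * ?G * ?V)"
    then have ij: "i < ?N" "j < ?N"
      by simp_all
    have "(transpose_mat ?V * ?G * ?V) $$ (i, j) =
        (\<Sum>k<?N. \<Sum>l<?N. p i (x k) * ?G $$ (k, l) * p j (x l))"
      unfolding index_triple_prod_mat[OF V(2) G V(1) ij] using ij by simp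
    also have "\<dots> = (LINT y:S|M. p i y * p j y)"
      by (simp only: gram_matrix_bilinear[OF M S cont] p[OF ij(1), symmetric] p[OF ij(2), symmetric])
    finally show "gram_matrix n p S M $$ (i, j) = (transpose_mat ?V * ?G * ?V) $$ (i, j)"
      using ij by (simp add: gram_matrix_index del: index_mult_mat)
  qed (simp_all add: gram_matrix_def Let_def)
  then show ?thesis
    using det_mult[OF mult_carrier_mat[OF V(2) G] V(1)] det_mult[OF V(2) G] det_transpose[OF V(1)]
    by (simp add: vdm_def Let_def power2_eq_square del: assoc_mult_mat)
qed

section \<open>Finitely supported measures\<close>

text \<open>Weights sit on indices rather than on points, so \<open>z\<close> may repeat a point and
  the masses then add up. This allows moving mass to a point that is already a node. As an image of
  a point measure, it integrates by finite sums.\<close>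

definition atomic_measure ::
    "'i set \<Rightarrow> ('i \<Rightarrow> real) \<Rightarrow> ('i \<Rightarrow> 'a::topological_space) \<Rightarrow> 'a measure" where
  "atomic_measure I u z = distr (point_measure I (\<lambda>i. ennreal (u i))) borel z"

lemma atomic_measure_in_prob_measures_on:
  assumes I: "finite I" and u: "\<And>i. i \<in> I \<Longrightarrow> 0 \<le> u i" "(\<Sum>i\<in>I. u i) = 1"
    and z: "\<And>i. i \<in> I \<Longrightarrow> z i \<in> S" and S: "closed S"
  shows "atomic_measure I u z \<in> prob_measures_on S"
proof -
  have "prob_space (point_measure I (\<lambda>i. ennreal (u i)))"
    using I u by (intro prob_space_point_measure) (simp_all add: sum_ennreal)
  moreover have "z -` (- S) \<inter> I = {}"
    using z by auto
  ultimately show ?thesis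
    using S I by (auto simp: prob_measures_on_def atomic_measure_def emeasure_distr
        space_point_measure intro!: prob_space.prob_space_distr)
qed

lemma set_integral_atomic_measure:
  fixes f :: "'a::topological_space \<Rightarrow> real"
  assumes I: "finite I" and u: "\<And>i. i \<in> I \<Longrightarrow> 0 \<le> u i"
    and z: "\<And>i. i \<in> I \<Longrightarrow> z i \<in> S" and S: "closed S" and f: "f \<in> borel_measurable borel"
  shows "(LINT y:S|atomic_measure I u z. f y) = (\<Sum>i\<in>I. u i * f (z i))"
proof -
  have "(\<lambda>y. indicator S y *\<^sub>R f y) \<in> borel_measurable borel"
    using S f by (intro borel_measurable_scaleR borel_measurable_indicator) auto
  then have "(LINT y:S|atomic_measure I u z. f y) = (\<Sum>i\<in>I. u i *\<^sub>R (indicator S (z i) *\<^sub>R f (z i)))"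
    unfolding set_lebesgue_integral_def atomic_measure_def
    using I u by (simp add: integral_distr lebesgue_integral_point_measure_finite)
  also have "\<dots> = (\<Sum>i\<in>I. u i * f (z i))"
    using z by (intro sum.cong) auto
  finally show ?thesis .
qed

text \<open>Brings the measure of the theorem into the indexed form, for which integrals and Gram
  determinants are computed.\<close>

lemma discrete_measure_eq_atomic_measure:
  assumes F: "finite F" and w: "\<And>a. a \<in> F \<Longrightarrow> 0 \<le> w a" and x: "bij_betw x I F"
  shows "discrete_measure F w = atomic_measure I (\<lambda>i. w (x i)) x"
proof (rule measure_eqI)
  show "sets (discrete_measure F w) = sets (atomic_measure I (\<lambda>i. w (x i)) x)"
    by (simp add: atomic_measure_def)
  fix A assume "A \<in> sets (discrete_measure F w)"
  then have A: "A \<in> sets borel"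
    by simp
  have I: "finite I"
    using F x bij_betw_finite by blast
  have "emeasure (discrete_measure F w) A = (\<Sum>a\<in>F. ennreal (w a) * indicator A a)"
    using A by (simp add: emeasure_discrete_measure)
  also have "\<dots> = (\<Sum>i\<in>I. ennreal (w (x i)) * indicator A (x i))"
    by (rule sum.reindex_bij_betw[OF x, symmetric])
  also have "\<dots> = (\<Sum>i\<in>x -` A \<inter> I. ennreal (w (x i)))"
    using I by (intro sum.mono_neutral_cong_right) (auto simp: indicator_def)
  also have "\<dots> = emeasure (atomic_measure I (\<lambda>i. w (x i)) x) A"
    unfolding atomic_measure_def
    using A I by (subst emeasure_distr) (simp_all add: space_point_measure emeasure_point_measure_finite)
  finally show "emeasure (discrete_measure F w) A = emeasure (atomic_measure I (\<lambda>i. w (x i)) x) A" .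
qed

text \<open>The Gram matrix factors as V^T diag(u) V. No Lagrange polynomials enter, so the formula
  is available before \<open>vdm\<close> is known to be nonzero.\<close>

lemma det_gram_matrix_atomic:
  fixes S :: "(real^'d) set" and n :: nat
  defines "N \<equiv> dim_polys TYPE('d) n"
  assumes basis: "poly_basis n p" and S: "closed S"
    and u: "\<And>i. i < N \<Longrightarrow> 0 \<le> u i" and x: "\<And>i. i < N \<Longrightarrow> x i \<in> S"
  shows "Determinant.det (gram_matrix n p S (atomic_measure {..<N} u x)) = (\<Prod>i<N. u i) * (vdm n p x)\<^sup>2"
proof -
  let ?V = "Matrix.mat N N (\<lambda>(i, j). p j (x i))"
  let ?D = "Matrix.mat N N (\<lambda>(i, j). if i = j then u i else 0)"
  have V: "?V \<in> carrier_mat N N" "transpose_mat ?V \<in> carrier_mat N N" and D: "?D \<in> carrier_mat N N"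
    by auto
  have p: "p i \<in> borel_measurable borel" if "i < N" for i
    using basis that by (intro borel_measurable_polys[of _ n]) (simp add: poly_basis_def Let_def N_def)
  have "gram_matrix n p S (atomic_measure {..<N} u x) = transpose_mat ?V * ?D * ?V"
  proof (rule eq_matI)
    fix i j assume "i < dim_row (transpose_mat ?V * ?D * ?V)" "j < dim_col (transpose_mat ?V * ?D * ?V)"
    then have ij: "i < N" "j < N"
      by simp_all
    have "gram_matrix n p S (atomic_measure {..<N} u x) $$ (i, j) =
        (LINT y:S|atomic_measure {..<N} u x. p i y * p j y)"
      using ij by (simp add: gram_matrix_index N_def)
    also have "\<dots> = (\<Sum>k<N. u k * (p i (x k) * p j (x k)))"
      using u x p ij S by (intro set_integral_atomic_measure borel_measurable_times) auto
    \<comment> \<open>The single sum is padded to a double sum to match the entry formula of a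
      triple product with a diagonal middle factor.\<close>
    also have "\<dots> = (\<Sum>k<N. \<Sum>l<N. if l = k then p i (x k) * u k * p j (x k) else 0)"
      by (simp add: mult_ac)
    also have "\<dots> = (transpose_mat ?V * ?D * ?V) $$ (i, j)"
      unfolding index_triple_prod_mat[OF V(2) D V(1) ij] using ij by (intro sum.cong refl) auto
    finally show "gram_matrix n p S (atomic_measure {..<N} u x) $$ (i, j) =
        (transpose_mat ?V * ?D * ?V) $$ (i, j)" .
  qed (simp_all add: gram_matrix_def Let_def N_def)
  then show ?thesis
    using det_mult[OF mult_carrier_mat[OF V(2) D] V(1)] det_mult[OF V(2) D] det_transpose[OF V(1)]
    by (simp add: vdm_def Let_def power2_eq_square det_diagonal_mat N_def del: assoc_mult_mat)
qed

section \<open>Equality in AM-GM and the first-order condition\<close>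

text \<open>This is the equality case of AM-GM. The numbers r = N u_i have mean 1 and product at
  least 1, so the nonnegative quantities r - 1 - ln r have sum at most 0. Each is therefore 0, which
  forces r = 1.\<close>

lemma weights_eq_inverse_card:
  fixes u :: "nat \<Rightarrow> real"
  assumes u: "\<And>i. i < N \<Longrightarrow> 0 < u i" "(\<Sum>i<N. u i) = 1"
    and le: "(1 / real N) ^ N \<le> (\<Prod>i<N. u i)" and i: "i < N"
  shows "u i = 1 / real N"
proof -
  have N: "real N > 0"
    using i by simp
  have pos: "0 < real N * u i" if "i < N" for i
    using N u(1)[OF that] by simp
  have "1 = real N ^ N * (1 / real N) ^ N"
    using N by (simp add: power_mult_distrib[symmetric])
  also have "\<dots> \<le> (\<Prod>i<N. real N * u i)"
    using le N by (simp add: prod.distrib)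
  finally have "0 \<le> ln (\<Prod>i<N. real N * u i)"
    by simp
  also have "\<dots> = (\<Sum>i<N. ln (real N * u i))"
    using pos by (intro ln_prod) (force dest: less_imp_neq simp del: mult_eq_0_iff)+
  finally have "(\<Sum>i<N. real N * u i - 1 - ln (real N * u i)) \<le> 0"
    using u(2) by (simp add: sum_subtractf sum_distrib_left[symmetric])
  moreover have nonneg: "0 \<le> real N * u i - 1 - ln (real N * u i)" if "i < N" for i
    using ln_le_minus_one[OF pos[OF that]] by simp
  ultimately have "(\<Sum>i<N. real N * u i - 1 - ln (real N * u i)) = 0"
    by (intro antisym sum_nonneg) auto
  from sum_nonneg_0[OF _ _ this, of i] have "real N * u i - 1 - ln (real N * u i) = 0"
    using nonneg i by simp
  then have "real N * u i = 1"
    using pos[OF i] by (intro ln_eq_minus_one) auto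
  then show ?thesis
    using N by (simp add: field_simps)
qed

text \<open>The hypothesis is the optimality of the uniform weights against moving mass \<open>t\<close> to a new point;
  the conclusion is read off the derivative at \<open>t = 0\<close>.\<close>

lemma le_1_if_mixture_le:
  fixes s :: real
  assumes N: "N > 0"
    and le: "\<And>t. 0 < t \<Longrightarrow> t < 1 \<Longrightarrow>
      ((1 - t) / real N) ^ N * (1 + t / ((1 - t) / real N) * s) \<le> (1 / real N) ^ N"
  shows "s \<le> 1"
proof (rule ccontr)
  assume "\<not> s \<le> 1"
  then have s: "s > 1"
    by simp
  obtain m where m: "N = Suc m"
    using N gr0_implies_Suc by blast
  \<comment> \<open>This is the left side of the hypothesis divided by
    \<open>(1 / real N) ^ N\<close>. One factor \<open>(1 - t) / real N\<close> is multiplied into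
    the bracket to clear its denominator, which leaves the exponent m = N - 1; also f 0 = 1.\<close>
  define f where "f t = (1 - t) ^ m * ((1 - t) + t * real N * s)" for t
  have der: "DERIV f 0 :> real N * (s - 1)"
    unfolding f_def by (auto intro!: derivative_eq_intros simp: m algebra_simps)
  have "0 < real N * (s - 1)"
    using s N by simp
  from DERIV_pos_inc_right[OF der this] obtain d where d: "d > 0" "\<And>t. 0 < t \<Longrightarrow> t < d \<Longrightarrow> f 0 < f t"
    by auto
  \<comment> \<open>Small enough for \<open>f\<close> to have increased, and below 1 so that the
    hypothesis applies.\<close>
  define t where "t = min (d / 2) (1 / 2)"
  have t: "0 < t" "t < 1" "t < d"
    using d(1) by (auto simp: t_def min_def)
  have "((1 - t) / real N) ^ N * (1 + t / ((1 - t) / real N) * s) = f t * (1 / real N) ^ N"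
  proof -
    have "((1 - t) / real N) ^ N * (1 + t / ((1 - t) / real N) * s) =
        ((1 - t) / real N) ^ m * ((1 - t) / real N * (1 + t / ((1 - t) / real N) * s))"
      by (simp only: m power_Suc2 mult.assoc)
    also have "(1 - t) / real N * (1 + t / ((1 - t) / real N) * s) = ((1 - t) + t * real N * s) * (1 / real N)"
      using t N by (simp add: field_simps)
    also have "((1 - t) / real N) ^ m = (1 - t) ^ m * (1 / real N) ^ m"
      by (simp add: power_divide)
    finally show ?thesis
      by (simp only: f_def m power_Suc2 mult_ac)
  qed
  then have "f t * (1 / real N) ^ N \<le> 1 * (1 / real N) ^ N"
    using le[OF t(1,2)] by simp
  then have "f t \<le> 1"
    using N by (simp del: mult_1_left)
  moreover have "f 0 < f t"
    using d(2) t by blast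
  ultimately show False
    by (simp add: f_def)
qed

section \<open>Gram determinants in the Lagrange basis\<close>

text \<open>The trace of \<open>?H\<close> is the integral of the sum of squares of the Lagrange
  polynomials, hence at most 1, and \<open>?H\<close> is positive semidefinite. The bound follows
  from the exponential estimate.\<close>

lemma det_gram_matrix_lagrange_le:
  fixes S :: "(real^'d) set" and n :: nat
  defines "N \<equiv> dim_polys TYPE('d) n"
  assumes basis: "poly_basis n p" and vdm: "vdm n p x \<noteq> 0"
    and M: "M \<in> prob_measures_on S" and S: "compact S"
    and le: "\<And>y. y \<in> S \<Longrightarrow> (\<Sum>i<N. (lagrange n x i y)\<^sup>2) \<le> 1"
  shows "Determinant.det (gram_matrix n (lagrange n x) S M) \<le> (1 / real N) ^ N"
proof -
  let ?H = "gram_matrix n (lagrange n x) S M"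
  have N: "real N > 0"
    by (simp add: N_def)
  note H = gram_matrix_carrier[of n "lagrange n x" S M, folded N_def]
  note H_index = gram_matrix_index[where S = S and M = M and q = "lagrange n x" and n = n, folded N_def]
  have cont: "continuous_on UNIV (lagrange n x i)" if "i < N" for i
    using lagrange_polys[OF basis vdm] that unfolding N_def by (blast intro: continuous_on_polys)
  note int = set_integrable_compact_prob[OF M S]
  have "(\<Sum>i<N. ?H $$ (i, i)) = (LINT y:S|M. (\<Sum>i<N. (lagrange n x i y)\<^sup>2))"
  proof -
    have "(\<Sum>i<N. ?H $$ (i, i)) = (\<Sum>i<N. (LINT y:S|M. (lagrange n x i y)\<^sup>2))"
      by (intro sum.cong refl) (simp add: H_index power2_eq_square)
    also have "\<dots> = (LINT y|M. (\<Sum>i<N. indicator S y *\<^sub>R (lagrange n x i y)\<^sup>2))"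
      unfolding set_lebesgue_integral_def
      by (intro Bochner_Integration.integral_sum[symmetric] int[unfolded set_integrable_def]
          continuous_intros cont) simp
    finally show ?thesis
      by (simp only: set_lebesgue_integral_def scaleR_sum_right)
  qed
  also have "\<dots> \<le> (LINT y:S|M. 1)"
    by (intro set_integral_mono int continuous_intros cont le) simp_all
  also have "\<dots> \<le> 1"
  proof -
    have "prob_space M" "S \<in> sets M"
      using M S by (simp_all add: prob_measures_on_def borel_compact)
    then interpret prob_space M
      by simp
    show ?thesis
      using \<open>S \<in> sets M\<close> by (subst set_integral_const) (simp_all add: emeasure_finite)
  qed
  finally have trace: "(\<Sum>i<N. ?H $$ (i, i)) \<le> 1" .
  \<comment> \<open>Scaling by N brings the trace to at most N, so the exponent is at most 0; the
    determinant gains the factor N^N.\<close>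
  have "Determinant.det (real N \<cdot>\<^sub>m ?H) \<le> exp ((\<Sum>i<N. (real N \<cdot>\<^sub>m ?H) $$ (i, i)) - real N)"
  proof (rule det_psd_le_exp_trace)
    show "real N \<cdot>\<^sub>m ?H \<in> carrier_mat N N"
      using H by simp
    show "(real N \<cdot>\<^sub>m ?H) $$ (i, j) = (real N \<cdot>\<^sub>m ?H) $$ (j, i)" if "i < N" "j < N" for i j
      using H that by (simp add: H_index mult.commute)
    show "0 \<le> (\<Sum>i<N. \<Sum>j<N. v i * (real N \<cdot>\<^sub>m ?H) $$ (i, j) * v j)" for v
    proof -
      have "(\<Sum>i<N. \<Sum>j<N. v i * (real N \<cdot>\<^sub>m ?H) $$ (i, j) * v j) =
          real N * (\<Sum>i<N. \<Sum>j<N. v i * ?H $$ (i, j) * v j)"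
        unfolding sum_distrib_left using H by (intro sum.cong refl) simp
      also have "(\<Sum>i<N. \<Sum>j<N. v i * ?H $$ (i, j) * v j) =
          (LINT y:S|M. (\<Sum>i<N. v i * lagrange n x i y) * (\<Sum>i<N. v i * lagrange n x i y))"
        unfolding N_def by (rule gram_matrix_bilinear[OF M S cont[unfolded N_def]])
      also have "real N * \<dots> \<ge> 0"
        unfolding set_lebesgue_integral_def using N
        by (intro mult_nonneg_nonneg Bochner_Integration.integral_nonneg) auto
      finally show ?thesis .
    qed
  qed
  also have "(\<Sum>i<N. (real N \<cdot>\<^sub>m ?H) $$ (i, i)) = real N * (\<Sum>i<N. ?H $$ (i, i))"
    unfolding sum_distrib_left using H by (intro sum.cong refl) simp
  also have "exp (real N * (\<Sum>i<N. ?H $$ (i, i)) - real N) \<le> 1"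
    using trace N mult_left_mono[OF trace, of "real N"] by simp
  finally have "real N ^ N * Determinant.det ?H \<le> 1"
    using H by simp
  then show ?thesis
    using N by (simp add: power_divide field_simps)
qed

text \<open>Index \<open>N\<close> carries the new point \<open>y\<close> with mass
  \<open>t\<close>. By the values of the Lagrange polynomials at the nodes, the other indices
  contribute the scalar matrix (1 - t)/N, while \<open>y\<close> contributes a rank-one
  term.\<close>

lemma det_gram_matrix_lagrange_mixture:
  fixes S :: "(real^'d) set" and n :: nat and t :: real
  defines "N \<equiv> dim_polys TYPE('d) n"
  assumes basis: "poly_basis n p" and vdm: "vdm n p x \<noteq> 0" and S: "closed S"
    and x: "\<And>i. i < N \<Longrightarrow> x i \<in> S" and y: "y \<in> S" and t: "0 < t" "t < 1"
  defines "M \<equiv> atomic_measure {..N} (\<lambda>i. if i < N then (1 - t) / real N else t) (\<lambda>i. if i < N then x i else y)"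
  shows "M \<in> prob_measures_on S"
    and "Determinant.det (gram_matrix n (lagrange n x) S M) =
      ((1 - t) / real N) ^ N * (1 + t / ((1 - t) / real N) * (\<Sum>i<N. (lagrange n x i y)\<^sup>2))"
proof -
  have N: "real N > 0"
    by (simp add: N_def)
  have split: "{..N} = insert N {..<N}"
    by auto
  show "M \<in> prob_measures_on S"
    unfolding M_def using t N x y S
    by (intro atomic_measure_in_prob_measures_on) (auto simp: split)
  have "gram_matrix n (lagrange n x) S M = Matrix.mat N N (\<lambda>(i, j).
      (if i = j then (1 - t) / real N else 0) + t * (lagrange n x i y * lagrange n x j y))" (is "_ = ?R")
  proof (rule eq_matI)
    fix i j assume "i < dim_row ?R" "j < dim_col ?R"
    then have ij: "i < N" "j < N"
      by simp_all
    have meas: "lagrange n x k \<in> borel_measurable borel" if "k < N" for k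
      using lagrange_polys[OF basis vdm] that unfolding N_def by (blast intro: borel_measurable_polys)
    have "gram_matrix n (lagrange n x) S M $$ (i, j) =
        (LINT y:S|M. lagrange n x i y * lagrange n x j y)"
      using ij by (simp add: gram_matrix_index N_def)
    also have "\<dots> = (\<Sum>k\<in>{..N}. (if k < N then (1 - t) / real N else t) *
        (lagrange n x i (if k < N then x k else y) * lagrange n x j (if k < N then x k else y)))"
      unfolding M_def using t N x y S meas ij
      by (intro set_integral_atomic_measure borel_measurable_times) auto
    also have "\<dots> = t * (lagrange n x i y * lagrange n x j y) +
        (\<Sum>k<N. (1 - t) / real N * (lagrange n x i (x k) * lagrange n x j (x k)))"
      by (simp add: split)
    also have "(\<Sum>k<N. (1 - t) / real N * (lagrange n x i (x k) * lagrange n x j (x k))) =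
        (\<Sum>k<N. if k = i then if i = j then (1 - t) / real N else 0 else 0)"
      using ij by (intro sum.cong refl) (auto simp: lagrange_node[OF basis vdm] N_def)
    also have "\<dots> = (if i = j then (1 - t) / real N else 0)"
      using ij by simp
    finally show "gram_matrix n (lagrange n x) S M $$ (i, j) = ?R $$ (i, j)"
      using ij by simp
  qed (simp_all add: gram_matrix_def Let_def N_def)
  then have "Determinant.det (gram_matrix n (lagrange n x) S M) = Determinant.det ?R"
    by simp
  also have "\<dots> = ((1 - t) / real N) ^ N * (1 + t / ((1 - t) / real N) * (\<Sum>i<N. (lagrange n x i y)\<^sup>2))"
    using t N by (intro det_scalar_plus_rank_one) simp
  finally show "Determinant.det (gram_matrix n (lagrange n x) S M) =
      ((1 - t) / real N) ^ N * (1 + t / ((1 - t) / real N) * (\<Sum>i<N. (lagrange n x i y)\<^sup>2))" .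
qed

section \<open>Optimal discrete measures and Fejer sets\<close>

theorem proposition0p5:
  fixes n :: nat
    and S F :: "(real^'d) set"
    and p :: "nat \<Rightarrow> real^'d \<Rightarrow> real"
    and w :: "real^'d \<Rightarrow> real"
  assumes "n \<ge> 1"
    and "int CARD('d) simplex S"
    and "poly_basis n p"
    and "F \<subseteq> S"
    and "card F = dim_polys TYPE('d) n"
    and "\<forall>a\<in>F. w a > 0"
    and "(\<Sum>a\<in>F. w a) = 1"
  shows "optimal_measure n p S (discrete_measure F w) \<longleftrightarrow>
    (\<forall>a\<in>F. w a = 1 / real (dim_polys TYPE('d) n)) \<and> fejer_set n p S F"
proof -
  note basis = assms(3)
  let ?N = "dim_polys TYPE('d) n"
  have N: "?N > 0"
    by simp
  have compact: "compact S" and closed: "closed S"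
    using assms(2) by (auto intro: compact_simplex closed_simplex)
  \<comment> \<open>An infinite set has \<open>card\<close> 0, whereas \<open>?N\<close> is
    positive.\<close>
  have F: "finite F"
    using assms(5) N card.infinite by fastforce
  have mu: "discrete_measure F w = atomic_measure {..<?N} (\<lambda>i. w (x i)) x"
    if "bij_betw x {..<?N} F" for x
    using F assms(6) that by (intro discrete_measure_eq_atomic_measure) (auto intro: less_imp_le)
  show ?thesis
  proof
    assume opt: "optimal_measure n p S (discrete_measure F w)"
    obtain x where x: "bij_betw x {..<?N} F"
      using ex_bij_betw_nat_finite[OF F] assms(5) by (auto simp: atLeast0LessThan)
    have xS: "x i \<in> S" and w: "w (x i) > 0" if "i < ?N" for i
      using bij_betwE[OF x] assms(4,6) that by auto
    define D where "D = Determinant.det (gram_matrix n p S (discrete_measure F w))"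
    have D: "D = (\<Prod>i<?N. w (x i)) * (vdm n p x)\<^sup>2"
      unfolding D_def mu[OF x] using w xS
      by (intro det_gram_matrix_atomic[OF basis closed]) (auto intro: less_imp_le)
    have max: "Determinant.det (gram_matrix n p S \<nu>) \<le> D" if "\<nu> \<in> prob_measures_on S" for \<nu>
      using opt that by (simp add: D_optimal_def D_def)
    \<comment> \<open>The competitor is the uniform measure on N points. It is used twice: with
      unisolvent points to show D > 0, and with the points of \<open>F\<close> to force equal
      weights.\<close>
    have uniform: "(1 / real ?N) ^ ?N * (vdm n p z)\<^sup>2 \<le> D" if "\<And>i. i < ?N \<Longrightarrow> z i \<in> S" for z
    proof -
      have "atomic_measure {..<?N} (\<lambda>_. 1 / real ?N) z \<in> prob_measures_on S"
        using that N by (intro atomic_measure_in_prob_measures_on closed) auto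
      from max[OF this] show ?thesis
        using that by (simp add: det_gram_matrix_atomic[OF basis closed])
    qed
    \<comment> \<open>Full affine dimension identifies the interior with the relative interior,
      which is nonempty for a nonempty convex set.\<close>
    have "interior S \<noteq> {}"
    proof -
      have "rel_interior S = interior S"
        using aff_dim_simplex[OF assms(2)] by (intro interior_rel_interior) simp
      moreover have "S \<noteq> {}"
        using assms(2) by auto
      ultimately show ?thesis
        using rel_interior_eq_empty[OF convex_simplex[OF assms(2)]] by simp
    qed
    from exists_vdm_ne_0[OF basis this] obtain z where z: "\<And>i. z i \<in> S" "vdm n p z \<noteq> 0"
      by metis
    have "0 < (1 / real ?N) ^ ?N * (vdm n p z)\<^sup>2"
      using N z(2) by simp
    also have "\<dots> \<le> D"
      using z(1) by (rule uniform)
    finally have vdm: "vdm n p x \<noteq> 0"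
      by (auto simp: D)
    have "(1 / real ?N) ^ ?N \<le> (\<Prod>i<?N. w (x i))"
      using uniform[of x, OF xS] vdm by (simp add: D)
    moreover have "(\<Sum>i<?N. w (x i)) = 1"
      using sum.reindex_bij_betw[OF x, of w] assms(7) by simp
    ultimately have wx: "w (x i) = 1 / real ?N" if "i < ?N" for i
      using weights_eq_inverse_card[of ?N "\<lambda>i. w (x i)"] w that by blast
    have le: "(\<Sum>i<?N. (lagrange n x i y)\<^sup>2) \<le> 1" if y: "y \<in> S" for y
    proof (rule le_1_if_mixture_le[OF N])
      fix t :: real assume t: "0 < t" "t < 1"
      note mix = det_gram_matrix_lagrange_mixture[OF basis vdm closed xS y t]
      \<comment> \<open>Both determinants carry the factor \<open>(vdm n p x)\<^sup>2\<close>;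
        cancelling it leaves the comparison in Lagrange coordinates, where the value of the given
        measure is N^(-N).\<close>
      from max[OF mix(1)]
      show "((1 - t) / real ?N) ^ ?N * (1 + t / ((1 - t) / real ?N) * (\<Sum>i<?N. (lagrange n x i y)\<^sup>2))
          \<le> (1 / real ?N) ^ ?N"
        using vdm by (simp only: det_gram_matrix_lagrange[OF basis vdm mix(1) compact] mix(2) D)
          (simp add: wx mult.commute[of _ "(vdm n p x)\<^sup>2"])
    qed
    \<comment> \<open>At a node exactly one Lagrange polynomial is 1 and the others are 0, so the
      bound 1 is attained.\<close>
    have "(\<Sum>i<?N. (lagrange n x i (x 0))\<^sup>2) = (\<Sum>i<?N. if i = 0 then 1 else 0)"
      using N by (intro sum.cong refl) (auto simp: lagrange_node[OF basis vdm])
    also have "\<dots> = 1"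
      using N by simp
    finally have "fejer_set n p S F"
      unfolding fejer_set_def Let_def using assms(4) x vdm le xS[OF N] by blast
    moreover have "\<forall>a\<in>F. w a = 1 / real ?N"
      using wx bij_betw_imp_surj_on[OF x] by auto
    ultimately show "(\<forall>a\<in>F. w a = 1 / real ?N) \<and> fejer_set n p S F"
      by blast
  next
    assume fejer: "(\<forall>a\<in>F. w a = 1 / real ?N) \<and> fejer_set n p S F"
    then obtain x where x: "bij_betw x {..<?N} F" and vdm: "vdm n p x \<noteq> 0"
      and le: "\<And>y. y \<in> S \<Longrightarrow> (\<Sum>i<?N. (lagrange n x i y)\<^sup>2) \<le> 1"
      unfolding fejer_set_def Let_def by blast
    have xF: "x i \<in> F" and xS: "x i \<in> S" if "i < ?N" for i
      using bij_betwE[OF x] assms(4) that by auto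
    have wx: "w (x i) = 1 / real ?N" if "i < ?N" for i
      using fejer xF[OF that] by blast
    have D: "Determinant.det (gram_matrix n p S (discrete_measure F w)) =
        (1 / real ?N) ^ ?N * (vdm n p x)\<^sup>2"
      unfolding mu[OF x] using xS by (subst det_gram_matrix_atomic[OF basis closed]) (simp_all add: wx)
    show "optimal_measure n p S (discrete_measure F w)"
      unfolding D_optimal_def
    proof (intro conjI ballI)
      show "discrete_measure F w \<in> prob_measures_on S"
        unfolding mu[OF x] using xS N wx by (intro atomic_measure_in_prob_measures_on closed) auto
      fix \<nu> assume \<nu>: "\<nu> \<in> prob_measures_on S"
      \<comment> \<open>The squared Vandermonde factor is common to all competitors, so only the
        Lagrange Gram determinant has to be bounded.\<close>
      have "Determinant.det (gram_matrix n p S \<nu>) =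
          Determinant.det (gram_matrix n (lagrange n x) S \<nu>) * (vdm n p x)\<^sup>2"
        by (simp add: det_gram_matrix_lagrange[OF basis vdm \<nu> compact])
      also have "\<dots> \<le> (1 / real ?N) ^ ?N * (vdm n p x)\<^sup>2"
        by (intro mult_right_mono det_gram_matrix_lagrange_le[OF basis vdm \<nu> compact le]) simp_all
      finally show "Determinant.det (gram_matrix n p S \<nu>) \<le>
          Determinant.det (gram_matrix n p S (discrete_measure F w))"
        by (simp add: D)
    qed
  qed
qed

end
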